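(* Let $C_n(q,q')$ denote the number of cyclic permutations of length $n$ avoiding both patterns $q$ and $q'$. Then: (1) for $n\geq 5$, $C_n(123,321)=0$; (2) for $n\geq 3$, $C_n(231,312)=0$; (3) for all positive integers $n$, $C_n(231,321)=1$; (4) for all positive integers $n$, $C_n(132,321)=\phi(n)$, where $\phi$ is Euler's totient function.
   Context: A permutation of length $n$ is a linear order $p=p_1p_2\cdots p_n$ of $[n]=\{1,\dots,n\}$, also viewed as the bijection $i\mapsto p_i$. It is cyclic if, as a bijection of $[n]$, it consists of a single cycle of length $n$. A permutation $p$ contains a pattern $q=q_1\cdots q_k$ if there are indices $i_1<\cdots<i_k$ such that for all $j,r$, $q_j<q_r$ iff $p_{i_j}<p_{i_r}$; otherwise $p$ avoids $q$. $\phi(n)$ is the number of integers in $\{1,\dots,n\}$ relatively prime to $n$. *)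

theory Defs
  imports "HOL-Combinatorics.Combinatorics" "HOL-Number_Theory.Number_Theory"
begin

text \<open>
  A permutation of length \<open>n\<close> is a function \<open>p\<close> with \<open>p permutes {1..n}\<close>; its one-line notation
  is \<open>p 1, \<dots>, p n\<close>. (Being the identity outside \<open>{1..n}\<close> makes the representing function unique.)
  A pattern is given by its one-line notation as a list, whose positions are counted from \<open>0\<close>.
\<close>

definition contains_pattern :: "nat \<Rightarrow> (nat \<Rightarrow> nat) \<Rightarrow> nat list \<Rightarrow> bool" where
  "contains_pattern n p q \<longleftrightarrow>
     (\<exists>i :: nat \<Rightarrow> nat.
        strict_mono_on {..<length q} i \<and> i ` {..<length q} \<subseteq> {1..n} \<and>
        (\<forall>j < length q. \<forall>r < length q. q ! j < q ! r \<longleftrightarrow> p (i j) < p (i r)))"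

abbreviation avoids_pattern :: "nat \<Rightarrow> (nat \<Rightarrow> nat) \<Rightarrow> nat list \<Rightarrow> bool" where
  "avoids_pattern n p q \<equiv> \<not> contains_pattern n p q"

definition cyclic_avoiders :: "nat \<Rightarrow> nat list \<Rightarrow> nat list \<Rightarrow> (nat \<Rightarrow> nat) set" where
  "cyclic_avoiders n q q' =
     {p. p permutes {1..n} \<and> cyclic_on p {1..n} \<and> avoids_pattern n p q \<and> avoids_pattern n p q'}"

definition num_cyclic_avoiders :: "nat \<Rightarrow> nat list \<Rightarrow> nat list \<Rightarrow> nat" where
  "num_cyclic_avoiders n q q' = card (cyclic_avoiders n q q')"

text \<open>The set counted is finite, so \<open>card\<close> is not taking its default value \<open>0\<close>.\<close>

lemma finite_cyclic_avoiders: "finite (cyclic_avoiders n q q')"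
  by (rule finite_subset[OF _ finite_permutations[of "{1..n}"]])
    (auto simp: cyclic_avoiders_def)

end

theory Submission
  imports Defs
begin

text \<open>
  (1) Already five entries contain a monotone triple, by Erdos and Szekeres.

  (2) A permutation avoiding \<open>231\<close> and \<open>312\<close> satisfies \<open>p (p 1) = 1\<close>, so it has a cycle of length
  at most \<open>2\<close>.

  (3) Avoiding \<open>231\<close> and \<open>321\<close> means that every entry has at most one larger entry before it.
  Inductively, if \<open>1, \<dots>, k - 1\<close> stand at positions \<open>2, \<dots>, k\<close>, then \<open>k\<close> stands at position \<open>1\<close>,
  which closes a cycle on \<open>{1..k}\<close>, or at position \<open>k + 1\<close>. So the only cyclic avoider is
  \<open>n, 1, \<dots>, n - 1\<close>.

  (4) Let \<open>m\<close> be the position of \<open>n\<close>. Avoiding \<open>132\<close> puts larger values before \<open>m\<close> than after it, and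
  avoiding \<open>321\<close> makes the entries after \<open>m\<close> increasing and, if \<open>m < n\<close>, also those up to \<open>m\<close>. As
  \<open>m = n\<close> would give a fixed point, the cyclic avoiders are rotations, and the rotation by \<open>k\<close> is
  cyclic iff \<open>k\<close> is coprime to \<open>n\<close>.
\<close>

section \<open>Patterns of length three, and invariant sets of cyclic permutations\<close>

text \<open>Both directions of each comparison appear because \<open>x\<close>, \<open>y\<close>,
  \<open>z\<close> are arbitrary and may coincide.\<close>

lemma contains_pattern_3:
  "contains_pattern n p [x, y, z] \<longleftrightarrow>
     (\<exists>a b c. 1 \<le> a \<and> a < b \<and> b < c \<and> c \<le> n \<and>
        (x < y \<longleftrightarrow> p a < p b) \<and> (y < x \<longleftrightarrow> p b < p a) \<and>
        (x < z \<longleftrightarrow> p a < p c) \<and> (z < x \<longleftrightarrow> p c < p a) \<and>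
        (y < z \<longleftrightarrow> p b < p c) \<and> (z < y \<longleftrightarrow> p c < p b))"
    (is "?L \<longleftrightarrow> ?R")
proof
  assume ?L
  then obtain i :: "nat \<Rightarrow> nat" where mono: "strict_mono_on {..<3} i"
    and sub: "i ` {..<3} \<subseteq> {1..n}"
    and ord: "\<And>j r. j < 3 \<Longrightarrow> r < 3 \<Longrightarrow> [x, y, z] ! j < [x, y, z] ! r \<longleftrightarrow> p (i j) < p (i r)"
    unfolding contains_pattern_def by (auto simp: numeral_3_eq_3)
  have "i 0 < i 1" "i 1 < i 2"
    using mono by (auto simp: strict_mono_on_def)
  moreover have "i 0 \<in> {1..n}" "i 2 \<in> {1..n}"
    using sub by (auto simp: image_subset_iff simp del: One_nat_def)
  ultimately show ?R
    using ord[of 0 1] ord[of 1 0] ord[of 0 2] ord[of 2 0] ord[of 1 2] ord[of 2 1]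
    by (intro exI[of _ "i 0"] exI[of _ "i 1"] exI[of _ "i 2"]) simp
next
  assume ?R
  then obtain a b c where abc: "1 \<le> a" "a < b" "b < c" "c \<le> n"
    "x < y \<longleftrightarrow> p a < p b" "y < x \<longleftrightarrow> p b < p a" "x < z \<longleftrightarrow> p a < p c"
    "z < x \<longleftrightarrow> p c < p a" "y < z \<longleftrightarrow> p b < p c" "z < y \<longleftrightarrow> p c < p b"
    by blast
  have "strict_mono_on {..<3} (\<lambda>t. [a, b, c] ! t)"
    using abc(2,3) by (auto simp: strict_mono_on_def numeral_3_eq_3 less_Suc_eq)
  with abc show ?L
    unfolding contains_pattern_def
    by (intro exI[of _ "\<lambda>t. [a, b, c] ! t"]) (simp add: lessThan_Suc All_less_Suc numeral_3_eq_3)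
qed

lemma avoids_pattern_3D:
  assumes "avoids_pattern n p [x, y, z]" "1 \<le> a" "a < b" "b < c" "c \<le> n"
  shows "\<not> ((x < y \<longleftrightarrow> p a < p b) \<and> (y < x \<longleftrightarrow> p b < p a) \<and>
            (x < z \<longleftrightarrow> p a < p c) \<and> (z < x \<longleftrightarrow> p c < p a) \<and>
            (y < z \<longleftrightarrow> p b < p c) \<and> (z < y \<longleftrightarrow> p c < p b))"
    (is "\<not> ?P")
proof (rule notI)
  assume "?P"
  with assms(2-5) have "contains_pattern n p [x, y, z]"
    unfolding contains_pattern_3 by (intro exI[of _ a] exI[of _ b] exI[of _ c] conjI) simp_all
  with assms(1) show False by contradiction
qed

text \<open>The orbit of a point of \<open>A\<close> stays inside \<open>A\<close>, but under a
  cyclic permutation it is all of \<open>S\<close>. This rules out fixed points and short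
  cycles.\<close>

lemma cyclic_on_invariant_subset:
  assumes cyc: "cyclic_on p S" and sub: "A \<subseteq> S" and ne: "A \<noteq> {}"
    and inv: "\<And>x. x \<in> A \<Longrightarrow> p x \<in> A"
  shows "A = S"
proof -
  from ne obtain a where a: "a \<in> A" by blast
  have "S = orbit p a"
    using cyc a sub orbit_cyclic_eq3 by fastforce
  moreover have "x \<in> A" if "x \<in> orbit p a" for x
    using that by induction (use a inv in auto)
  ultimately show ?thesis using sub by blast
qed

section \<open>The pair 123, 321\<close>

lemma no_avoider_123_321:
  assumes p: "p permutes {1..n}" and n: "5 \<le> n"
    and av: "avoids_pattern n p [1, 2, 3]" "avoids_pattern n p [3, 2, 1]"
  shows False
proof -
  have inc: "\<not> (p a < p b \<and> p b < p c)" and dec: "\<not> (p c < p b \<and> p b < p a)"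
    if "1 \<le> a" "a < b" "b < c" "c \<le> 5" for a b c
    using avoids_pattern_3D[OF av(1), of a b c] avoids_pattern_3D[OF av(2), of a b c] that n
    by auto
  have total: "p a < p b \<or> p b < p a" if "a < b" for a b
    using permutes_inj[OF p] that by (metis injD less_irrefl linorder_neqE_nat)
  show False
    \<comment> \<open>The ten triples among the first five positions turn the claim into a finite
      propositional problem.\<close>
    using inc[of 1 2 3] inc[of 1 2 4] inc[of 1 2 5] inc[of 1 3 4] inc[of 1 3 5] inc[of 1 4 5]
      inc[of 2 3 4] inc[of 2 3 5] inc[of 2 4 5] inc[of 3 4 5]
      dec[of 1 2 3] dec[of 1 2 4] dec[of 1 2 5] dec[of 1 3 4] dec[of 1 3 5] dec[of 1 4 5]
      dec[of 2 3 4] dec[of 2 3 5] dec[of 2 4 5] dec[of 3 4 5]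
      total[of 1 2] total[of 1 3] total[of 1 4] total[of 1 5] total[of 2 3] total[of 2 4]
      total[of 2 5] total[of 3 4] total[of 3 5] total[of 4 5]
    by simp argo
qed

section \<open>The pair 231, 312\<close>

text \<open>
  If \<open>p j = 1\<close>, then avoiding \<open>231\<close> puts the first \<open>j\<close> values at or below \<open>p 1\<close>, and avoiding \<open>312\<close>
  puts all values up to \<open>p 1\<close> at the first \<open>j\<close> positions; hence \<open>j = p 1\<close>.
\<close>
lemma avoids_231_312_first_entry:
  assumes p: "p permutes {1..n}" and n: "1 \<le> n"
    and av: "avoids_pattern n p [2, 3, 1]" "avoids_pattern n p [3, 1, 2]"
  shows "p (p 1) = 1"
proof -
  have no231: "\<not> (p c < p a \<and> p a < p b)" and no312: "\<not> (p b < p c \<and> p c < p a)"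
    if "1 \<le> a" "a < b" "b < c" "c \<le> n" for a b c
    using avoids_pattern_3D[OF av(1), of a b c] avoids_pattern_3D[OF av(2), of a b c] that
    by auto
  have inj: "inj p" using permutes_inj[OF p] .
  have pin: "p i \<in> {1..n}" if "i \<in> {1..n}" for i
    using permutes_in_image[OF p] that by blast
  have "1 \<in> p ` {1..n}" using permutes_image[OF p] n by simp
  then obtain j where j: "j \<in> {1..n}" "p j = 1" by auto
  have "p ` {1..j} = {1..p 1}"
  proof (intro equalityI subsetI)
    fix y assume "y \<in> p ` {1..j}"
    then obtain i where i: "i \<in> {1..j}" "y = p i" by auto
    have "p i \<le> p 1"
    proof (rule ccontr)
      assume gt: "\<not> p i \<le> p 1"
      then have "i \<noteq> 1" by auto
      moreover have "i \<noteq> j" using gt j pin[of 1] n by auto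
      \<comment> \<open>If \<open>p 1 = 1\<close>, injectivity gives \<open>j = 1\<close>, which
        leaves only \<open>i = 1\<close>.\<close>
      moreover have "p 1 \<noteq> 1"
        using calculation inj j(2) i gt
        by (metis atLeastAtMost_iff injD le_antisym)
      ultimately show False
        using no231[of 1 i j] i j gt pin[of 1] n by auto
    qed
    then show "y \<in> {1..p 1}" using i j pin[of i] by auto
  next
    fix y assume y: "y \<in> {1..p 1}"
    then have "y \<in> p ` {1..n}" using permutes_image[OF p] pin[of 1] n by simp
    then obtain i where i: "i \<in> {1..n}" "y = p i" by auto
    have "i \<le> j"
    proof (rule ccontr)
      assume gt: "\<not> i \<le> j"
      have "p i \<noteq> p 1" "p i \<noteq> p j"
        using gt j inj by (metis injD le_refl atLeastAtMost_iff)+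
      moreover have "j \<noteq> 1" using calculation y i j by auto
      ultimately show False
        using no312[of 1 j i] i j y gt by auto
    qed
    then show "y \<in> p ` {1..j}" using i by auto
  qed
  moreover have "card (p ` {1..j}) = j"
    using card_image[OF inj_on_subset[OF inj subset_UNIV], of "{1..j}"] by simp
  ultimately have "j = p 1" by simp
  with j show ?thesis by simp
qed

lemma no_cyclic_avoider_231_312:
  assumes p: "p permutes {1..n}" and n: "3 \<le> n" and cyc: "cyclic_on p {1..n}"
    and av: "avoids_pattern n p [2, 3, 1]" "avoids_pattern n p [3, 1, 2]"
  shows False
proof -
  have "p (p 1) = 1" using avoids_231_312_first_entry[OF p _ av] n by simp
  moreover have "p 1 \<in> {1..n}" using permutes_in_image[OF p] n by simp
  ultimately have "{1, p 1} = {1..n}"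
    by (intro cyclic_on_invariant_subset[OF cyc]) (use n in auto)
  then have "card {1..n} \<le> 2" using card_insert_le_m1[of 2 "{p 1}" 1] by simp
  with n show False by simp
qed

section \<open>Rotations and when they are cyclic\<close>

text \<open>Positions start at 1, so the residue is taken from \<open>i - 1\<close>; fixing all
  points outside the interval is what \<open>permutes\<close> demands.\<close>

definition rot :: "nat \<Rightarrow> nat \<Rightarrow> nat \<Rightarrow> nat" where
  "rot n k i = (if i \<in> {1..n} then (i - 1 + k) mod n + 1 else i)"

lemma rot_in_range: "i \<in> {1..n} \<Longrightarrow> rot n k i \<in> {1..n}"
  by (auto simp: rot_def Suc_le_eq)

lemma rot_rot: "rot n k (rot n l i) = rot n (k + l) i"
  using rot_in_range[of i n l] by (auto simp: rot_def mod_simps add_ac)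

lemma rot_n: "rot n n i = i"
proof (cases "i \<in> {1..n}")
  case True
  then have "(i - 1 + n) mod n = i - 1" by (subst mod_add_self2) auto
  with True show ?thesis by (simp add: rot_def)
qed (auto simp: rot_def)

lemma rot_funpow: "i \<in> {1..n} \<Longrightarrow> (rot n k ^^ j) i = rot n (j * k) i"
  by (induction j) (auto simp: rot_rot, auto simp: rot_def)

lemma rot_eq:
  assumes "i \<in> {1..n}" "k \<le> n"
  shows "rot n k i = (if i + k \<le> n then i + k else i + k - n)"
  using assms by (auto simp: rot_def mod_if)

lemma rot_permutes:
  assumes "k \<le> n"
  shows "rot n k permutes {1..n}"
proof (rule bij_imp_permutes)
  show "bij_betw (rot n k) {1..n} {1..n}"
    by (rule bij_betw_byWitness[where f' = "rot n (n - k)"])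
      (use assms rot_in_range in \<open>auto simp: rot_rot rot_n\<close>)
qed (auto simp: rot_def)

text \<open>Iterating adds multiples of \<open>k\<close> modulo \<open>n\<close>, so 1 reaches every
  point exactly when \<open>k\<close> is invertible modulo \<open>n\<close>.\<close>

lemma cyclic_on_rot_iff:
  assumes n: "1 \<le> n" and k: "k \<le> n"
  shows "cyclic_on (rot n k) {1..n} \<longleftrightarrow> coprime k n"
proof
  assume cyc: "cyclic_on (rot n k) {1..n}"
  show "coprime k n"
  proof (cases "n = 1")
    case False
    \<comment> \<open>Reaching 2 from 1 in \<open>j\<close> steps makes \<open>j\<close> an inverse
      of \<open>k\<close> modulo \<open>n\<close>.\<close>
    have "2 \<in> {1..n}" using n False by simp
    also have "{1..n} = orbit (rot n k) 1"
      using orbit_cyclic_eq3[OF cyc, of 1] n by simp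
    finally obtain j where "(rot n k ^^ j) 1 = 2"
      unfolding orbit_altdef by auto
    then have "(j * k) mod n = 1" using n by (simp add: rot_funpow rot_def)
    then have "[k * j = 1] (mod n)" using n False by (simp add: cong_def mult.commute)
    then show ?thesis by (auto simp: coprime_iff_invertible_nat)
  qed simp
next
  assume cop: "coprime k n"
  have perm: "permutation (rot n k)"
    by (rule permutes_imp_permutation[OF finite_atLeastAtMost rot_permutes[OF k]])
  have "x \<in> orbit (rot n k) 1" if x: "x \<in> {1..n}" for x
  proof -
    obtain j where j: "[k * j = 1] (mod n)"
      using cong_solve_coprime_nat[OF cop] by auto
    have "[k * j * (x - 1) = 1 * (x - 1)] (mod n)"
      by (intro cong_mult j cong_refl)
    moreover have "(x - 1) mod n = x - 1" using x by (intro mod_less) auto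
    ultimately have "(j * (x - 1) * k) mod n = x - 1"
      by (simp add: cong_def mult_ac)
    then have "(rot n k ^^ (j * (x - 1))) 1 = x"
      using x n by (simp add: rot_funpow rot_def)
    then show ?thesis
      \<comment> \<open>For a permutation the orbit may be described with exponent 0 allowed, which
        covers \<open>x = 1\<close>.\<close>
      unfolding orbit_altdef_permutation[OF perm]
      by (intro CollectI exI[of _ "j * (x - 1)"] conjI TrueI) (rule sym)
  qed
  moreover have "x \<in> {1..n}" if "x \<in> orbit (rot n k) 1" for x
    using that by induction (use n rot_in_range in auto)
  ultimately have "{1..n} = orbit (rot n k) 1" by blast
  then show "cyclic_on (rot n k) {1..n}"
    unfolding cyclic_on_def using n by (metis atLeastAtMost_iff le_refl)
qed

text \<open>The one-line notation is \<open>k + 1, ..., n, 1, ..., k\<close>: at most two increasing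
  runs, the first above the second. An inversion has its larger entry in the first run, so any
  earlier entry is smaller than that one but exceeds the other.\<close>

lemma rot_avoids_132_321:
  assumes "k \<le> n"
  shows "avoids_pattern n (rot n k) [1, 3, 2]" "avoids_pattern n (rot n k) [3, 2, 1]"
proof -
  have "\<not> (rot n k a < rot n k c \<and> rot n k c < rot n k b)"
    "\<not> (rot n k c < rot n k b \<and> rot n k b < rot n k a)"
    if "1 \<le> a" "a < b" "b < c" "c \<le> n" for a b c
    using that assms rot_eq[of a n k] rot_eq[of b n k] rot_eq[of c n k]
    by (auto split: if_splits)
  then show "avoids_pattern n (rot n k) [1, 3, 2]" "avoids_pattern n (rot n k) [3, 2, 1]"
    unfolding contains_pattern_3 by (simp_all, blast+)
qed

text \<open>Induction up from 1 gives \<open>i \<le> p i\<close>, induction down from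
  \<open>n\<close> gives \<open>p i \<le> i\<close>.\<close>

lemma strict_mono_permutes_id:
  assumes p: "p permutes {1..n::nat}"
    and mono: "\<And>i j. 1 \<le> i \<Longrightarrow> i < j \<Longrightarrow> j \<le> n \<Longrightarrow> p i < p j"
  shows "p i = i"
proof (cases "i \<in> {1..n}")
  case True
  have ge: "1 \<le> i \<Longrightarrow> i \<le> n \<Longrightarrow> i \<le> p i" for i
  proof (induction i)
    case (Suc i)
    then show ?case
      using mono[of i "Suc i"] permutes_in_image[OF p, of "Suc i"] by (cases "i = 0") auto
  qed simp
  have le: "n - d \<ge> 1 \<Longrightarrow> p (n - d) \<le> n - d" for d
  proof (induction d)
    case 0
    then show ?case using permutes_in_image[OF p, of n] by auto
  next
    case (Suc d)
    then show ?case using mono[of "n - Suc d" "n - d"] by force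
  qed
  from True have "n - (n - i) = i" by auto
  then show ?thesis using ge[of i] le[of "n - i"] True by force
qed (use p in \<open>auto simp: permutes_def\<close>)

section \<open>The pair 231, 321\<close>

lemma cyclic_avoider_231_321:
  assumes p: "p permutes {1..n}" and n: "1 \<le> n" and cyc: "cyclic_on p {1..n}"
    and av: "avoids_pattern n p [2, 3, 1]" "avoids_pattern n p [3, 2, 1]"
  shows "p = rot n (n - 1)"
proof -
  have inj: "inj p" using permutes_inj[OF p] .
  have pin: "p i \<in> {1..n}" if "i \<in> {1..n}" for i
    using permutes_in_image[OF p] that by blast
  \<comment> \<open>The two patterns differ only in the order of their first two entries.\<close>
  have two_larger: "\<not> (p c < p a \<and> p c < p b)" if "1 \<le> a" "a < b" "b < c" "c \<le> n" for a b c
  proof -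
    have "p a \<noteq> p b" using inj that by (metis injD less_irrefl)
    then show ?thesis
      using avoids_pattern_3D[OF av(1), of a b c] avoids_pattern_3D[OF av(2), of a b c] that
      by auto
  qed
  have step: "Suc k \<le> n \<Longrightarrow> 1 \<le> k \<Longrightarrow> p (Suc k) = k" for k
  proof (induction k rule: less_induct)
    case (less k)
    have prev: "p i = i - 1" if "2 \<le> i" "i \<le> k" for i
      using less.IH[of "i - 1"] less.prems that by simp
    have "k \<in> p ` {1..n}" using permutes_image[OF p] less.prems by simp
    then obtain j where j: "j \<in> {1..n}" "p j = k" by auto
    have "p 1 \<noteq> k"
    proof
      assume eq: "p 1 = k"
      have "p x \<in> {1..k}" if "x \<in> {1..k}" for x
        using that eq prev[of x] by (cases "x = 1") auto
      then have "{1..k} = {1..n}"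
        using less.prems by (intro cyclic_on_invariant_subset[OF cyc]) auto
      then show False using less.prems by (auto dest: arg_cong[where f = card])
    qed
    then have jk: "k < j"
      using j prev[of j] by (cases "j = 1") force+
    \<comment> \<open>Values below \<open>k\<close> already occupy positions 2 to \<open>k\<close>,
      so positions 1 and \<open>Suc k\<close> carry larger ones if they precede the position
      \<open>j\<close> of \<open>k\<close>.\<close>
    have large: "k < p i" if i: "i \<in> {1, Suc k}" "i < j" for i
    proof (rule ccontr)
      assume "\<not> k < p i"
      moreover have "p i \<noteq> k" using inj j i by (metis injD less_irrefl)
      moreover have "p i \<ge> 1" using pin[of i] i less.prems by auto
      ultimately have "p (Suc (p i)) = p i" using less.IH[of "p i"] less.prems by auto
      then have "Suc (p i) = i" using inj by (rule injD[rotated])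
      with i \<open>\<not> k < p i\<close> \<open>p i \<noteq> k\<close> \<open>p i \<ge> 1\<close> show False by auto
    qed
    show ?case
    proof (rule ccontr)
      assume "p (Suc k) \<noteq> k"
      then have "Suc k < j" using j jk by (cases "j = Suc k") auto
      then show False
        using two_larger[of 1 "Suc k" j] large[of 1] large[of "Suc k"] j less.prems by auto
    qed
  qed
  have eq: "p i = rot n (n - 1) i" if i: "i \<noteq> 1" for i
  proof (cases "i \<in> {1..n}")
    case True
    then show ?thesis using step[of "i - 1"] i by (auto simp: rot_eq)
  next
    case False
    then show ?thesis using p by (auto simp: permutes_def rot_def)
  qed
  have "p 1 = n"
  proof -
    have "n \<in> p ` {1..n}" using permutes_image[OF p] n by simp
    then obtain i where i: "i \<in> {1..n}" "p i = n" by auto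
    then have "i = 1" using step[of "i - 1"] by (cases "i = 1") auto
    with i show ?thesis by simp
  qed
  then have "p 1 = rot n (n - 1) 1" using n by (simp add: rot_eq)
  with eq show ?thesis by (metis ext)
qed

text \<open>Both patterns end in a descent, but the entries from position 2 on increase.\<close>

lemma rot_avoids_231_321:
  "avoids_pattern n (rot n (n - 1)) [2, 3, 1]" "avoids_pattern n (rot n (n - 1)) [3, 2, 1]"
proof -
  have pred: "rot n (n - 1) i = i - 1" if "1 < i" "i \<le> n" for i
    using that by (simp add: rot_eq)
  have incr: "\<not> rot n (n - 1) c < rot n (n - 1) b"
    if "1 \<le> a" "a < b" "b < c" "c \<le> n" for a b c
  proof -
    have "rot n (n - 1) b = b - 1" "rot n (n - 1) c = c - 1"
      using that pred[of b] pred[of c] by linarith+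
    with that show ?thesis by linarith
  qed
  show "avoids_pattern n (rot n (n - 1)) [2, 3, 1]"
  proof
    assume "contains_pattern n (rot n (n - 1)) [2, 3, 1]"
    then obtain a b c where abc: "1 \<le> a" "a < b" "b < c" "c \<le> n"
      and "rot n (n - 1) c < rot n (n - 1) b"
      unfolding contains_pattern_3 by auto
    then show False using incr[OF abc] by simp
  qed
  show "avoids_pattern n (rot n (n - 1)) [3, 2, 1]"
  proof
    assume "contains_pattern n (rot n (n - 1)) [3, 2, 1]"
    then obtain a b c where abc: "1 \<le> a" "a < b" "b < c" "c \<le> n"
      and "rot n (n - 1) c < rot n (n - 1) b"
      unfolding contains_pattern_3 by auto
    then show False using incr[OF abc] by simp
  qed
qed

section \<open>The pair 132, 321\<close>

lemma cyclic_avoider_132_321: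
  assumes p: "p permutes {1..n}" and n: "2 \<le> n" and cyc: "cyclic_on p {1..n}"
    and av: "avoids_pattern n p [1, 3, 2]" "avoids_pattern n p [3, 2, 1]"
  shows "\<exists>k \<in> totatives n. p = rot n k"
proof -
  have inj: "inj p" using permutes_inj[OF p] .
  have pin: "p i \<in> {1..n}" if "i \<in> {1..n}" for i
    using permutes_in_image[OF p] that by blast
  have no132: "\<not> (p a < p c \<and> p c < p b)" and no321: "\<not> (p c < p b \<and> p b < p a)"
    if "1 \<le> a" "a < b" "b < c" "c \<le> n" for a b c
    using avoids_pattern_3D[OF av(1), of a b c] avoids_pattern_3D[OF av(2), of a b c] that
    by auto
  have neq: "p a \<noteq> p b" if "a < b" for a b
    using inj that by (metis injD less_irrefl)
  have "n \<in> p ` {1..n}" using permutes_image[OF p] n by simp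
  then obtain m where m: "m \<in> {1..n}" "p m = n" by auto
  have "m \<noteq> n"
  proof
    assume "m = n"
    then have "{n} = {1..n}"
      using n m by (intro cyclic_on_invariant_subset[OF cyc]) auto
    then show False using n by (auto dest: arg_cong[where f = card])
  qed
  then have mn: "m < n" using m by simp
  have lt: "p i < n" if "i \<in> {1..n}" "i \<noteq> m" for i
    using pin[OF that(1)] inj that m by (metis atLeastAtMost_iff injD le_neq_implies_less)
  \<comment> \<open>Otherwise \<open>p i < p j < n\<close> makes positions \<open>i\<close>,
    \<open>m\<close>, \<open>j\<close> a 132.\<close>
  have left_right: "p j < p i" if "1 \<le> i" "i \<le> m" "m < j" "j \<le> n" for i j
    using no132[of i m j] that m lt[of j] neq[of i j] by (cases "i = m") auto
  \<comment> \<open>The last entry lies after \<open>m\<close>, hence below both; a descent before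
    it would complete a 321.\<close>
  have left: "p i < p j" if "1 \<le> i" "i < j" "j \<le> m" for i j
    using no321[of i j n] left_right[of j n] that mn neq[of i j] by auto
  have right: "p i < p j" if "m < i" "i < j" "j \<le> n" for i j
    using no321[of m i j] lt[of i] m that mn neq[of i j] by auto
  \<comment> \<open>Reading \<open>p\<close> from position \<open>m + 1\<close> on and wrapping
    around to \<open>m\<close> gives an increasing sequence, hence the identity; so \<open>p\<close>
    inverts the rotation by \<open>m\<close>.\<close>
  let ?q = "p \<circ> rot n m"
  have id: "?q i = i" for i
  proof (rule strict_mono_permutes_id)
    show "?q permutes {1..n}"
      using permutes_compose[OF rot_permutes p] mn by simp
    show "?q i < ?q j" if "1 \<le> i" "i < j" "j \<le> n" for i j
    proof -
      \<comment> \<open>Neither position wraps around, only that of \<open>j\<close> does, or both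
        do.\<close>
      consider "j + m \<le> n" | "i + m \<le> n" "n < j + m" | "n < i + m" by linarith
      then show ?thesis
      proof cases
        case 1
        then show ?thesis using right[of "i + m" "j + m"] that mn by (simp add: rot_eq)
      next
        case 2
        then show ?thesis
          using left_right[of "j + m - n" "i + m"] that mn by (simp add: rot_eq)
      next
        case 3
        then show ?thesis
          using left[of "i + m - n" "j + m - n"] that mn by (simp add: rot_eq)
      qed
    qed
  qed
  have "p i = rot n (n - m) i" for i
  proof -
    have "rot n m (rot n (n - m) i) = i" using mn by (simp add: rot_rot rot_n)
    then show ?thesis using id[of "rot n (n - m) i"] by simp
  qed
  then have eq: "p = rot n (n - m)" by blast
  moreover have "n - m \<in> totatives n"
    using cyc eq cyclic_on_rot_iff[of n "n - m"] n mn by (auto simp: totatives_def)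
  ultimately show ?thesis by blast
qed

section \<open>The sets of avoiders and their sizes\<close>

lemma cyclic_avoiders_132_321:
  assumes n: "1 \<le> n"
  shows "cyclic_avoiders n [1, 3, 2] [3, 2, 1] = rot n ` totatives n"
proof (intro equalityI subsetI)
  fix p assume "p \<in> cyclic_avoiders n [1, 3, 2] [3, 2, 1]"
  then have p: "p permutes {1..n}" "cyclic_on p {1..n}"
    "avoids_pattern n p [1, 3, 2]" "avoids_pattern n p [3, 2, 1]"
    by (auto simp: cyclic_avoiders_def)
  show "p \<in> rot n ` totatives n"
  proof (cases "n = 1")
    case True
    \<comment> \<open>Here the only totative is 1, and rotating by \<open>n = 1\<close> is the
      identity.\<close>
    then have "p = rot n 1" using p(1) rot_n[of n] by (auto simp: fun_eq_iff)
    with True show ?thesis by simp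
  next
    case False
    then show ?thesis using cyclic_avoider_132_321[OF p(1) _ p(2-4)] n by auto
  qed
qed (use n rot_permutes rot_avoids_132_321 cyclic_on_rot_iff in
      \<open>auto simp: cyclic_avoiders_def totatives_def\<close>)

text \<open>The image of 1 is \<open>k + 1\<close>, or 1 if \<open>k = n\<close>, and determines
  \<open>k\<close>. Shift 0 is left out because it agrees with shift \<open>n\<close>.\<close>

lemma inj_on_rot: "inj_on (rot n) {0<..n}"
proof (rule inj_onI)
  fix k l assume kl: "k \<in> {0<..n}" "l \<in> {0<..n}" and "rot n k = rot n l"
  then have "rot n k 1 = rot n l 1" by simp
  with kl show "k = l" by (auto simp: rot_eq split: if_splits)
qed

lemma cyclic_avoiders_231_321:
  assumes n: "1 \<le> n"
  shows "cyclic_avoiders n [2, 3, 1] [3, 2, 1] = {rot n (n - 1)}"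
proof -
  have "coprime (n - 1) n" using n by (intro coprime_diff_one_left_nat) simp
  then have "rot n (n - 1) \<in> cyclic_avoiders n [2, 3, 1] [3, 2, 1]"
    using rot_permutes[of "n - 1" n] cyclic_on_rot_iff[OF n, of "n - 1"] rot_avoids_231_321
    by (simp add: cyclic_avoiders_def)
  then show ?thesis
    using cyclic_avoider_231_321[OF _ n] by (auto simp: cyclic_avoiders_def)
qed

theorem theorem20:
  shows "(\<forall>n::nat. n \<ge> 5 \<longrightarrow> num_cyclic_avoiders n [1,2,3] [3,2,1] = 0)
       \<and> (\<forall>n::nat. n \<ge> 3 \<longrightarrow> num_cyclic_avoiders n [2,3,1] [3,1,2] = 0)
       \<and> (\<forall>n::nat. n \<ge> 1 \<longrightarrow> num_cyclic_avoiders n [2,3,1] [3,2,1] = 1)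
       \<and> (\<forall>n::nat. n \<ge> 1 \<longrightarrow> num_cyclic_avoiders n [1,3,2] [3,2,1] = totient n)"
proof (intro conjI allI impI)
  fix n :: nat assume "n \<ge> 5"
  then have "cyclic_avoiders n [1,2,3] [3,2,1] = {}"
    using no_avoider_123_321 by (auto simp: cyclic_avoiders_def)
  then show "num_cyclic_avoiders n [1,2,3] [3,2,1] = 0"
    by (simp add: num_cyclic_avoiders_def)
next
  fix n :: nat assume "n \<ge> 3"
  then have "cyclic_avoiders n [2,3,1] [3,1,2] = {}"
    using no_cyclic_avoider_231_312 by (auto simp: cyclic_avoiders_def)
  then show "num_cyclic_avoiders n [2,3,1] [3,1,2] = 0"
    by (simp add: num_cyclic_avoiders_def)
next
  fix n :: nat assume "n \<ge> 1"
  then show "num_cyclic_avoiders n [2,3,1] [3,2,1] = 1"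
    by (simp only: num_cyclic_avoiders_def cyclic_avoiders_231_321) simp
next
  fix n :: nat assume "n \<ge> 1"
  moreover have "inj_on (rot n) (totatives n)"
    by (rule inj_on_subset[OF inj_on_rot]) (auto simp: totatives_def)
  ultimately show "num_cyclic_avoiders n [1,3,2] [3,2,1] = totient n"
    by (simp only: num_cyclic_avoiders_def cyclic_avoiders_132_321 card_image totient_def)
qed

end
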